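(* Let $\Delta_u(d,n)$ denote the maximum diameter of the graph of a $d$-dimensional polyhedron with $n$ facets. Let $\varepsilon > 0$ and $d \geq 3$. Then for all sufficiently large $n$, \[ \Delta_u(d,n) \leq n^{1+\frac{1}{\ln 2}+\varepsilon}. \]
   Context: A polyhedron is the intersection of finitely many closed halfspaces; $d$ is the dimension of its affine span and $n$ the number of its facets. The diameter is the maximum over pairs of vertices of the edge-distance in the graph (1-skeleton). $\ln$ is the natural logarithm. *)

theory Defs
  imports "HOL-Analysis.Analysis"
begin

section \<open>The graph of a polyhedron and its diameter\<close>

definition graph_adj :: "'a::euclidean_space set \<Rightarrow> 'a \<Rightarrow> 'a \<Rightarrow> bool" where
  "graph_adj P u v \<longleftrightarrow>
     u extreme_point_of P \<and> v extreme_point_of P \<and> closed_segment u v edge_of P"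

text \<open>The length of a shortest path; it is \<open>\<infinity>\<close> if there is no path.\<close>

definition graph_dist :: "'a::euclidean_space set \<Rightarrow> 'a \<Rightarrow> 'a \<Rightarrow> enat" where
  "graph_dist P u v = (INF k \<in> {k. (graph_adj P ^^ k) u v}. enat k)"

definition graph_diameter :: "'a::euclidean_space set \<Rightarrow> enat" where
  "graph_diameter P =
     (SUP u \<in> {u. u extreme_point_of P}. SUP v \<in> {v. v extreme_point_of P}. graph_dist P u v)"

text \<open>
  The supremum is taken in \<open>enat\<close>, so that an upper bound for it is a bound for every polyhedron
  (on \<open>nat\<close>, the supremum of an unbounded set is \<open>0\<close>). A nonempty set of natural numbers with an
  upper bound contains its supremum, so under a finite bound this is a maximum.
  The polyhedra lie in the ambient space \<open>'a\<close> and need not be full-dimensional; lemma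
  \<open>Delta_u_ambient\<close> below shows that the value does not depend on \<open>'a\<close>, as long as
  the dimension of \<open>'a\<close> is at least \<open>d\<close>.
\<close>

definition Delta_u :: "'a::euclidean_space itself \<Rightarrow> nat \<Rightarrow> nat \<Rightarrow> enat" where
  "Delta_u _ d n =
     (SUP P \<in> {P :: 'a set. polyhedron P \<and> aff_dim P = int d \<and> card {F. F facet_of P} = n}.
        graph_diameter P)"


section \<open>Independence of the ambient space\<close>

definition realizes :: "'a::euclidean_space set \<Rightarrow> nat \<Rightarrow> nat \<Rightarrow> enat \<Rightarrow> bool" where
  "realizes P d n k \<longleftrightarrow> polyhedron P \<and> aff_dim P = int d \<and>
     card {F. F facet_of P} = n \<and> graph_diameter P = k"

lemma Delta_u_realizes:
  "Delta_u TYPE('a::euclidean_space) d n = Sup {k. \<exists>P::'a set. realizes P d n k}"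
  unfolding Delta_u_def realizes_def by (rule arg_cong[where f = Sup]) auto

lemma realizes_image:
  fixes h :: "'a::euclidean_space \<Rightarrow> 'b::euclidean_space"
  assumes face: "\<And>F G. h ` F face_of h ` G \<longleftrightarrow> F face_of G"
    and dim: "\<And>G. aff_dim (h ` G) = aff_dim G"
    and closed: "\<And>G. closed (h ` G) \<longleftrightarrow> closed G"
    and seg: "\<And>u v. h ` closed_segment u v = closed_segment (h u) (h v)"
    and inj: "inj h"
  shows "realizes (h ` P) d n k \<longleftrightarrow> realizes P d n k"
proof -
  have inj_image: "inj ((`) h)"
    using inj by (simp add: inj_on_def inj_image_eq_iff)
  have image_eq: "Collect R = (`) h ` {F. R (h ` F)}" if "\<And>G. R G \<Longrightarrow> G \<subseteq> h ` P" for R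
    using that by (fastforce simp: subset_image_iff)
  have "{G. G face_of h ` P} = (`) h ` {F. F face_of P}"
    using image_eq[of "\<lambda>G. G face_of h ` P"] by (simp add: face face_of_imp_subset)
  then have "finite {G. G face_of h ` P} \<longleftrightarrow> finite {F. F face_of P}"
    using inj_image by (metis finite_image_iff inj_on_subset subset_UNIV)
  moreover have "convex (h ` P) \<longleftrightarrow> convex P"
    using face[of P P] by (simp add: face_of_refl_eq)
  ultimately have poly: "polyhedron (h ` P) \<longleftrightarrow> polyhedron P"
    by (simp add: polyhedron_eq_finite_faces closed)
  have facet: "h ` F facet_of h ` P \<longleftrightarrow> F facet_of P" for F
    by (simp add: facet_of_def face dim)
  have "{G. G facet_of h ` P} = (`) h ` {F. F facet_of P}"
    using image_eq[of "\<lambda>G. G facet_of h ` P"] by (simp add: facet facet_of_imp_subset)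
  then have card: "card {G. G facet_of h ` P} = card {F. F facet_of P}"
    using inj_image by (metis card_image inj_on_subset subset_UNIV)
  have ext: "h u extreme_point_of h ` P \<longleftrightarrow> u extreme_point_of P" for u
    using face[of "{u}" P] by (simp add: face_of_singleton)
  have ext_imp: "z \<in> h ` P" if "z extreme_point_of h ` P" for z
    using that by (simp add: extreme_point_of_def)
  have ext_image: "{u. u extreme_point_of h ` P} = h ` {u. u extreme_point_of P}"
    using ext ext_imp by blast
  have adj: "graph_adj (h ` P) (h u) (h v) \<longleftrightarrow> graph_adj P u v" for u v
    by (simp add: graph_adj_def ext edge_of_def face dim flip: seg)
  have adj_range: "\<exists>y. w = h y" if "graph_adj (h ` P) z w" for z w
    using that ext_imp unfolding graph_adj_def by blast
  have walk: "(graph_adj (h ` P) ^^ j) (h u) (h v) \<longleftrightarrow> (graph_adj P ^^ j) u v" for j u v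
  proof (induction j arbitrary: v)
    case 0
    then show ?case using inj by (auto dest: injD)
  next
    case (Suc j)
    have "\<exists>y. w = h y" if "(graph_adj (h ` P) ^^ j) (h u) w" for w
      using that by (cases j) (auto dest: adj_range)
    then show ?case using Suc adj by (simp add: relcompp_apply) metis
  qed
  have "graph_diameter (h ` P) = graph_diameter P"
    by (simp add: graph_diameter_def graph_dist_def ext_image image_image walk)
  then show ?thesis by (simp add: realizes_def poly dim card)
qed

lemma realizes_translation:
  "realizes ((+) c ` P) d n k \<longleftrightarrow> realizes P d n k"
proof (rule realizes_image)
  show "closed ((+) c ` G) \<longleftrightarrow> closed G" for G
    using closed_translation[of G c] closed_translation[of "(+) c ` G" "- c"]
    by (auto simp: image_comp o_def)
  show "(+) c ` closed_segment u v = closed_segment (c + u) (c + v)" for u v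
    by (simp only: closed_segment_translation)
qed (simp_all add: face_of_translation_eq aff_dim_translation_eq)

lemma realizes_linear_image:
  fixes f :: "'a::euclidean_space \<Rightarrow> 'b::euclidean_space"
  assumes "linear f" "inj f"
  shows "realizes (f ` P) d n k \<longleftrightarrow> realizes P d n k"
  by (rule realizes_image)
    (use assms in \<open>auto simp: face_of_linear_image aff_dim_injective_linear_image
       closed_segment_linear_image closed_injective_linear_image_eq\<close>)

lemma realizes_transfer:
  assumes P: "realizes (P :: 'a::euclidean_space set) d n k" and d: "d \<le> DIM('b::euclidean_space)"
  shows "\<exists>Q :: 'b set. realizes Q d n k"
proof (cases "DIM('a) \<le> DIM('b)")
  case True
  then obtain f :: "'a \<Rightarrow> 'b" where f: "linear f" "\<And>x. norm (f x) = norm x"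
    using isometry_subset_subspace[of "UNIV :: 'a set" "UNIV :: 'b set"] by auto
  then have "inj f"
    by (metis linear_injective_0 norm_eq_zero)
  with f P show ?thesis using realizes_linear_image by blast
next
  case False
  from P have "aff_dim P = int d" by (simp add: realizes_def)
  then obtain p where p: "p \<in> P"
    by (metis aff_dim_empty all_not_in_conv of_nat_0_le_iff neg_0_le_iff_le not_one_le_zero)
  define P' where "P' = (+) (- p) ` P"
  have P': "realizes P' d n k" using P unfolding P'_def realizes_translation .
  have "0 \<in> P'" using p by (auto simp: P'_def)
  with P' have dimP': "dim P' = d"
    by (metis aff_dim_zero hull_inc of_nat_eq_iff realizes_def)
  obtain U where U: "subspace U" "P' \<subseteq> U" "dim U = DIM('b)"
  proof -
    obtain B where B: "B \<subseteq> P'" "independent B" "P' \<subseteq> span B" "card B = dim P'"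
      using basis_exists by blast
    obtain C where C: "B \<subseteq> C" "C \<subseteq> UNIV" "independent C" "UNIV \<subseteq> span C"
      by (rule maximal_independent_subset_extend[OF subset_UNIV B(2)])
    have "finite C" "card C = DIM('a)"
      using C(3) basis_card_eq_dim[OF C(2,4,3)]
      by (simp_all add: independent_imp_finite)
    then obtain D where D: "B \<subseteq> D" "D \<subseteq> C" "card D = DIM('b)"
      using exists_subset_between[of B "DIM('b)" C] B(4) C(1) dimP' d False
      by (metis nat_le_linear)
    show thesis
    proof
      show "subspace (span D)" by simp
      show "P' \<subseteq> span D" using B(3) span_mono[OF D(1)] by (rule subset_trans)
      show "dim (span D) = DIM('b)"
        using dim_span_eq_card_independent[OF independent_mono[OF C(3) D(2)]] D(3) by simp
    qed
  qed
  obtain g :: "'b \<Rightarrow> 'a" where g: "linear g" "range g = U" "\<And>x. norm (g x) = norm x"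
  proof -
    have "dim (UNIV :: 'b set) = dim U" using U(3) by simp
    then show thesis
      using isometries_subspaces[OF subspace_UNIV U(1)] that by (metis UNIV_I)
  qed
  then have "inj g"
    by (metis linear_injective_0 norm_eq_zero)
  have "g ` (g -` P') = P'" using g U by auto
  with P' \<open>inj g\<close> g show ?thesis using realizes_linear_image by metis
qed

lemma Delta_u_ambient:
  assumes "d \<le> DIM('a::euclidean_space)" and "d \<le> DIM('b::euclidean_space)"
  shows "Delta_u TYPE('a) d n = Delta_u TYPE('b) d n"
proof -
  have "{k. \<exists>P::'a set. realizes P d n k} = {k. \<exists>Q::'b set. realizes Q d n k}"
    using realizes_transfer[where 'a = 'a and 'b = 'b, OF _ assms(2)]
      realizes_transfer[where 'a = 'b and 'b = 'a, OF _ assms(1)] by blast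
  then show ?thesis by (simp add: Delta_u_realizes)
qed

end

theory Submission
  imports Defs "HOL-Real_Asymp.Real_Asymp"
begin

text \<open>
  For fixed \<open>d\<close> Larman's layer argument, in the style of Eisenbrand, Haehnle, Razborov and
  Rothvoss, gives the bound \<open>2 ^ d * (n + 1)\<close>, which is linear in \<open>n\<close>. Sort the vertices into
  layers by their distance from a fixed vertex. The graph of every face is connected (every vertex
  that does not minimise a linear functional has a neighbour with a smaller value), so the layers
  that a face meets form an interval. Cover the layers greedily by the intervals of facets, each
  time with the facet that reaches furthest. A facet then meets at most two of the chosen
  intervals, and induction on the dimension applies to each chosen facet.
\<close>

section \<open>Descending edges\<close>

text \<open>Constraints that are strict at \<open>u\<close> stay strict for small \<open>t\<close>
  by continuity, and a tight one only sees the sign of \<open>a h \<bullet> z\<close>. Since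
  \<open>F\<close> is finite, one range of \<open>t\<close> serves all constraints.\<close>

lemma eventually_feasible_direction:
  fixes u z :: "'a::euclidean_space"
  assumes "finite F" and F: "\<And>h. h \<in> F \<Longrightarrow> h = {x. a h \<bullet> x \<le> b h}"
    and u: "u \<in> \<Inter>F" and z: "\<And>h. h \<in> F \<Longrightarrow> a h \<bullet> u = b h \<Longrightarrow> a h \<bullet> z \<le> 0"
  shows "\<forall>\<^sub>F t in at_right 0. u + t *\<^sub>R z \<in> \<Inter>F"
proof -
  have "\<forall>\<^sub>F t in at_right 0. a h \<bullet> (u + t *\<^sub>R z) \<le> b h" if h: "h \<in> F" for h
  proof (cases "a h \<bullet> u = b h")
    case True
    have "\<forall>\<^sub>F t::real in at_right 0. t > 0"
      by (simp add: eventually_at_right_less)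
    then show ?thesis
    proof eventually_elim
      case (elim t)
      then have "t * (a h \<bullet> z) \<le> 0"
        using z[OF h True] by (simp add: mult_nonneg_nonpos)
      then show ?case using True by (simp add: inner_add_right)
    qed
  next
    case False
    have "a h \<bullet> u \<le> b h" using u F[OF h] h by blast
    with False have less: "a h \<bullet> u < b h" by simp
    have "((\<lambda>t. a h \<bullet> (u + t *\<^sub>R z)) \<longlongrightarrow> a h \<bullet> (u + 0 *\<^sub>R z)) (at_right 0)"
      by (intro tendsto_intros)
    then have "\<forall>\<^sub>F t in at_right 0. a h \<bullet> (u + t *\<^sub>R z) < b h"
      using less by (simp add: order_tendstoD(2))
    then show ?thesis by eventually_elim simp
  qed
  then have "\<forall>\<^sub>F t in at_right 0. \<forall>h\<in>F. a h \<bullet> (u + t *\<^sub>R z) \<le> b h"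
    using \<open>finite F\<close> by (simp add: eventually_ball_finite)
  then show ?thesis
    by eventually_elim (use F in blast)
qed

lemma extreme_point_no_line:
  fixes u w :: "'a::real_vector"
  assumes "u extreme_point_of S" "w \<noteq> 0" "u + t *\<^sub>R w \<in> S" "t > 0"
    "u - t *\<^sub>R w \<in> S"
  shows False
proof -
  have "u = midpoint (u + t *\<^sub>R w) (u - t *\<^sub>R w)"
    by (simp add: midpoint_def flip: scaleR_2)
  moreover have "u + t *\<^sub>R w \<noteq> u - t *\<^sub>R w"
  proof
    assume "u + t *\<^sub>R w = u - t *\<^sub>R w"
    then have "(2 * t) *\<^sub>R w = 0" by (simp add: algebra_simps flip: scaleR_2)
    with assms show False by simp
  qed
  ultimately have "u \<in> open_segment (u + t *\<^sub>R w) (u - t *\<^sub>R w)"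
    by (metis midpoint_in_open_segment)
  with assms show False by (auto simp: extreme_point_of_def)
qed

text \<open>A descent direction at \<open>u\<close> is tilted, without changing its
  \<open>c\<close>-slope, until it becomes parallel to the boundary of some halfspace tight at
  \<open>u\<close>. A short step along it then stays in the proper face cut out by that
  boundary.\<close>

lemma descending_proper_face:
  fixes S :: "'a::euclidean_space set"
  assumes S: "polyhedron S" and u: "u extreme_point_of S"
    and y: "y \<in> S" "c \<bullet> y < c \<bullet> u" and dim: "aff_dim S > 1"
  obtains T y' where "T face_of S" "T \<noteq> S" "u \<in> T" "y' \<in> T" "c \<bullet> y' < c \<bullet> u"
proof -
  obtain F where "finite F" and SF: "S = \<Inter>F"
    and "\<forall>h\<in>F. \<exists>a b. a \<noteq> 0 \<and> h = {x. a \<bullet> x \<le> b}"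
    using S unfolding polyhedron_def by blast
  then obtain a b where h_eq: "\<And>h. h \<in> F \<Longrightarrow> h = {x. a h \<bullet> x \<le> b h}"
    by metis
  have uS: "u \<in> S" using u by (simp add: extreme_point_of_def)
  \<comment> \<open>Dimension above 1 gives a point \<open>x\<close> off the line through
    \<open>u\<close> and \<open>y\<close>, hence a second direction to tilt along.\<close>
  have "\<not> S \<subseteq> affine hull {u, y}"
    using aff_dim_subset[of S "affine hull {u, y}"] aff_dim_2[of u y] dim
    by (auto split: if_splits)
  then obtain x where x: "x \<in> S" "x \<notin> affine hull {u, y}" by blast
  define z where "z = y - u"
  have cz: "c \<bullet> z < 0" using y by (simp add: z_def inner_diff_right)
  \<comment> \<open>Subtracting this multiple of \<open>z\<close> from \<open>x - u\<close> makes
    \<open>c\<close> vanish on \<open>w0\<close>; the result is nonzero because \<open>x\<close> is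
    off the line.\<close>
  define w0 where "w0 = (x - u) - (c \<bullet> (x - u) / (c \<bullet> z)) *\<^sub>R z"
  have cw0: "c \<bullet> w0 = 0" using cz by (simp add: w0_def inner_diff_right)
  have w0: "w0 \<noteq> 0"
  proof
    assume "w0 = 0"
    then have "x = u + (c \<bullet> (x - u) / (c \<bullet> z)) *\<^sub>R (y - u)"
      by (simp add: w0_def z_def algebra_simps)
    then have "x \<in> affine hull {u, y}"
      unfolding affine_hull_2_alt by blast
    with x show False by simp
  qed
  have az: "a h \<bullet> z \<le> 0" if "h \<in> F" "a h \<bullet> u = b h" for h
    using that y h_eq[OF that(1)] SF by (auto simp: z_def inner_diff_right)
  \<comment> \<open>If every constraint tight at \<open>u\<close> were constant along
    \<open>w0\<close>, small steps in both directions \<open>w0\<close> and \<open>- w0\<close>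
    would stay in \<open>S\<close>, so \<open>u\<close> would not be extreme.\<close>
  have "\<exists>h\<in>F. a h \<bullet> u = b h \<and> a h \<bullet> w0 \<noteq> 0"
  proof (rule ccontr)
    assume "\<not> ?thesis"
    then have "a h \<bullet> w0 = 0" if "h \<in> F" "a h \<bullet> u = b h" for h
      using that by blast
    then have "\<forall>\<^sub>F t in at_right 0. u + t *\<^sub>R w0 \<in> \<Inter>F"
      and "\<forall>\<^sub>F t in at_right 0. u + t *\<^sub>R (- w0) \<in> \<Inter>F"
      using uS SF by (intro eventually_feasible_direction[OF \<open>finite F\<close> h_eq]; simp)+
    moreover have "\<forall>\<^sub>F t::real in at_right 0. t > 0"
      by (simp add: eventually_at_right_less)
    ultimately have "\<forall>\<^sub>F t::real in at_right 0. False"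
    proof eventually_elim
      case (elim t)
      then show ?case using extreme_point_no_line[OF u w0, of t] SF by simp
    qed
    then show False by simp
  qed
  then obtain g where g: "g \<in> F" "a g \<bullet> u = b g" "a g \<bullet> w0 \<noteq> 0" by blast
  define w where "w = sgn (a g \<bullet> w0) *\<^sub>R w0"
  have cw: "c \<bullet> w = 0" using cw0 by (simp add: w_def)
  have gw: "a g \<bullet> w > 0" using g(3) by (simp add: w_def sgn_if)
  define A where "A = {h \<in> F. a h \<bullet> u = b h \<and> a h \<bullet> w > 0}"
  have A: "finite A" "g \<in> A" using \<open>finite F\<close> g gw by (auto simp: A_def)
  \<comment> \<open>Ratio test as in the simplex method: \<open>r h\<close> is the amount of tilt at
    which constraint \<open>h\<close> vanishes on \<open>z + r h *\<^sub>R w\<close>. The smallest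
    ratio keeps all tight constraints nonpositive and makes \<open>k\<close> zero.\<close>
  define r where "r h = - (a h \<bullet> z) / (a h \<bullet> w)" for h
  obtain k where k: "k \<in> A" "\<And>h. h \<in> A \<Longrightarrow> r k \<le> r h"
    using arg_min_if_finite[of A r] A by (metis empty_iff linorder_not_less)
  have kA: "k \<in> F" "a k \<bullet> u = b k" "a k \<bullet> w > 0" using k(1) by (auto simp: A_def)
  have r0: "r k \<ge> 0" using az[OF kA(1,2)] kA(3) by (simp add: r_def divide_nonpos_pos)
  define z' where "z' = z + r k *\<^sub>R w"
  have az': "a h \<bullet> z' \<le> 0" if h: "h \<in> F" "a h \<bullet> u = b h" for h
  proof (cases "a h \<bullet> w > 0")
    case True
    then have "r k \<le> r h" using h k(2) by (simp add: A_def)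
    then have "r k * (a h \<bullet> w) \<le> - (a h \<bullet> z)"
      using True by (simp add: r_def field_simps)
    then show ?thesis by (simp add: z'_def inner_add_right)
  next
    case False
    then have "r k * (a h \<bullet> w) \<le> 0" using r0 by (simp add: mult_nonneg_nonpos)
    then show ?thesis using az[OF h] by (simp add: z'_def inner_add_right)
  qed
  have kz': "a k \<bullet> z' = 0" using kA(3) by (simp add: z'_def inner_add_right inner_diff_right r_def)
  have cz': "c \<bullet> z' < 0" using cz cw by (simp add: z'_def inner_add_right)
  have "\<forall>\<^sub>F t in at_right 0. u + t *\<^sub>R z' \<in> \<Inter>F"
    using uS SF az' by (intro eventually_feasible_direction[OF \<open>finite F\<close> h_eq]) simp_all
  moreover have "\<forall>\<^sub>F t::real in at_right 0. t > 0"
    by (simp add: eventually_at_right_less)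
  ultimately have "\<forall>\<^sub>F t in at_right 0. t > 0 \<and> u + t *\<^sub>R z' \<in> \<Inter>F"
    by eventually_elim simp
  then obtain t where t: "t > 0" "u + t *\<^sub>R z' \<in> S"
    using eventually_happens' SF trivial_limit_at_right_real by blast
  define T where "T = S \<inter> {x. a k \<bullet> x = b k}"
  show thesis
  proof
    show "T face_of S"
      unfolding T_def
    proof (rule face_of_Int_supporting_hyperplane_le)
      show "convex S" using S by (rule polyhedron_imp_convex)
      show "a k \<bullet> x \<le> b k" if "x \<in> S" for x
        using that kA(1) h_eq SF by blast
    qed
    show "T \<noteq> S"
    proof
      assume "T = S"
      then have "a k \<bullet> y = b k" "a k \<bullet> x = b k" using y x by (auto simp: T_def)
      then have "a k \<bullet> z = 0" "a k \<bullet> (x - u) = 0"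
        using kA(2) by (auto simp: z_def inner_diff_right)
      then have "a k \<bullet> w = 0" by (simp add: w_def w0_def inner_diff_right)
      with kA(3) show False by simp
    qed
    show "u \<in> T" using uS kA(2) by (simp add: T_def)
    show "u + t *\<^sub>R z' \<in> T" using t kz' kA(2) by (simp add: T_def inner_add_right)
    show "c \<bullet> (u + t *\<^sub>R z') < c \<bullet> u"
      using t(1) cz' by (simp add: inner_add_right mult_pos_neg)
  qed
qed

text \<open>Passing to a proper face that contains \<open>u\<close> and still descends lowers the
  dimension, until the face is an edge. Faces of a face are faces of \<open>S\<close>, so this edge
  is an edge of \<open>S\<close>.\<close>

lemma descending_edge:
  fixes S :: "'a::euclidean_space set"
  assumes "polyhedron S" "u extreme_point_of S" "y \<in> S" "c \<bullet> y < c \<bullet> u"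
  shows "\<exists>E. E edge_of S \<and> u \<in> E \<and> (\<exists>y\<in>E. c \<bullet> y < c \<bullet> u)"
  using assms
proof (induction "nat (aff_dim S)" arbitrary: S y rule: less_induct)
  case less
  have u: "u \<in> S" using less.prems by (simp add: extreme_point_of_def)
  have "aff_dim {u, y} \<le> aff_dim S"
    using u less.prems by (intro aff_dim_subset) simp
  then have ge: "aff_dim S \<ge> 1" using less.prems by (auto simp: aff_dim_2 split: if_splits)
  show ?case
  proof (cases "aff_dim S = 1")
    case True
    then have "S edge_of S"
      using less.prems by (simp add: edge_of_def face_of_refl polyhedron_imp_convex)
    then show ?thesis using u less.prems by blast
  next
    case False
    then have "aff_dim S > 1" using ge by simp
    then obtain T y' where T: "T face_of S" "T \<noteq> S" "u \<in> T" "y' \<in> T" "c \<bullet> y' < c \<bullet> u"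
      using descending_proper_face less.prems by metis
    have "aff_dim T < aff_dim S"
      using T less.prems by (simp add: face_of_aff_dim_lt polyhedron_imp_convex)
    then have "nat (aff_dim T) < nat (aff_dim S)" using ge by simp
    moreover have "polyhedron T" using T less.prems face_of_polyhedron_polyhedron by blast
    moreover have "u extreme_point_of T" using T less.prems by (simp add: extreme_point_of_face)
    ultimately obtain E where "E edge_of T" "u \<in> E" "\<exists>y\<in>E. c \<bullet> y < c \<bullet> u"
      using less.hyps T by blast
    then show ?thesis using T(1) by (metis edge_of_def face_of_trans)
  qed
qed

text \<open>The descending edge starts at \<open>u\<close>, and the lower bound \<open>m\<close>
  prevents it from being a ray. It is therefore a segment, whose other end is the neighbour.\<close>

lemma descending_neighbour:
  fixes S :: "'a::euclidean_space set"
  assumes S: "polyhedron S" and u: "u extreme_point_of S"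
    and "y \<in> S" "c \<bullet> y < c \<bullet> u" and below: "\<And>x. x \<in> S \<Longrightarrow> m \<le> c \<bullet> x"
  shows "\<exists>w. graph_adj S u w \<and> c \<bullet> w < c \<bullet> u"
proof -
  obtain E y where E: "E edge_of S" "u \<in> E" and y: "y \<in> E" "c \<bullet> y < c \<bullet> u"
    using descending_edge assms by metis
  have face: "E face_of S" and dim: "aff_dim E = 1" using E by (auto simp: edge_of_def)
  have uE: "u extreme_point_of E" using face u E by (simp add: extreme_point_of_face)
  have "collinear E" using dim by (simp add: collinear_aff_dim)
  then obtain d where d: "\<And>x y. x \<in> E \<Longrightarrow> y \<in> E \<Longrightarrow> \<exists>r. x - y = r *\<^sub>R d"
    unfolding collinear_def by blast
  \<comment> \<open>\<open>M\<close> is the parameter at which \<open>c\<close> takes the value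
    \<open>m\<close> on the ray from \<open>u\<close> through \<open>y\<close>.\<close>
  define M where "M = (c \<bullet> u - m) / (c \<bullet> u - c \<bullet> y)"
  have "E \<subseteq> closed_segment u (u + M *\<^sub>R (y - u))"
  proof
    fix x assume x: "x \<in> E"
    obtain p q where pq: "x - u = p *\<^sub>R d" "y - u = q *\<^sub>R d" using d x y E by metis
    have "q \<noteq> 0" using pq y by auto
    define t where "t = p / q"
    have xt: "x = u + t *\<^sub>R (y - u)"
      using pq \<open>q \<noteq> 0\<close> by (simp add: t_def algebra_simps)
    have "t \<ge> 0"
    proof (rule ccontr)
      assume "\<not> t \<ge> 0"
      then have t: "t < 0" by simp
      \<comment> \<open>For negative \<open>t\<close> the point \<open>u\<close> lies strictly
        between \<open>x\<close> and \<open>y\<close>; this \<open>r\<close> is its position, the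
        solution of \<open>(1 - r) * t + r = 0\<close>.\<close>
      define r where "r = - t / (1 - t)"
      have r: "0 < r" "r < 1" using t by (simp_all add: r_def field_simps)
      have "(1 - r) * t + r = 0" using t by (simp add: r_def field_simps)
      moreover have "(1 - r) *\<^sub>R x + r *\<^sub>R y = u + ((1 - r) * t + r) *\<^sub>R (y - u)"
        by (simp add: xt algebra_simps)
      ultimately have "u = (1 - r) *\<^sub>R x + r *\<^sub>R y" by simp
      moreover have "x \<noteq> y"
      proof
        assume "x = y"
        then have "y - u = t *\<^sub>R (y - u)" by (subst xt[unfolded \<open>x = y\<close>]) simp
        then have "(1 - t) *\<^sub>R (y - u) = 0" by (simp add: scaleR_left_diff_distrib)
        then show False using t y by auto
      qed
      ultimately have "u \<in> open_segment x y" using r by (auto simp: in_segment)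
      then show False using uE x y by (auto simp: extreme_point_of_def)
    qed
    have "m \<le> c \<bullet> x" using x below face face_of_imp_subset by blast
    then have "t * (c \<bullet> u - c \<bullet> y) \<le> c \<bullet> u - m"
      by (simp add: xt inner_add_right inner_diff_right algebra_simps)
    then have "t \<le> M" using y by (simp add: M_def field_simps)
    show "x \<in> closed_segment u (u + M *\<^sub>R (y - u))"
    proof (cases "M = 0")
      case True
      then show ?thesis using \<open>t \<le> M\<close> \<open>t \<ge> 0\<close> xt by simp
    next
      case False
      then have "M > 0" using \<open>t \<le> M\<close> \<open>t \<ge> 0\<close> by simp
      then show ?thesis
        unfolding in_segment using \<open>t \<le> M\<close> \<open>t \<ge> 0\<close> xt
        by (intro exI[of _ "t / M"]) (simp add: algebra_simps)
    qed
  qed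
  then have "bounded E" using bounded_closed_segment bounded_subset by blast
  moreover have "closed E"
    using S face face_of_polyhedron_polyhedron polyhedron_imp_closed by blast
  ultimately have "compact E" by (simp add: compact_eq_bounded_closed)
  then obtain p q where pq: "E = closed_segment p q"
    using compact_convex_collinear_segment[of E] E \<open>collinear E\<close> face_of_imp_convex[OF face] by blast
  obtain w where w: "E = closed_segment u w"
    using uE pq by (metis extreme_point_of_segment closed_segment_commute)
  then have "w extreme_point_of S"
    using face extreme_point_of_face extreme_point_of_segment by blast
  then have "graph_adj S u w" using w E u by (simp add: graph_adj_def)
  moreover have "c \<bullet> w < c \<bullet> u"
  proof -
    obtain t where t: "0 \<le> t" "t \<le> 1" "y = (1 - t) *\<^sub>R u + t *\<^sub>R w"
      using y w by (auto simp: in_segment)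
    then have "t * (c \<bullet> w - c \<bullet> u) < 0"
      using y(2) by (simp add: inner_add_right left_diff_distrib right_diff_distrib)
    then show ?thesis using t(1) by (simp add: mult_less_0_iff)
  qed
  ultimately show ?thesis by blast
qed

text \<open>A vertex \<open>v\<close> is an exposed face, hence the unique minimiser of some
  functional \<open>c\<close> on \<open>S\<close>. From any other vertex a descending neighbour
  exists, and the number of vertices strictly below decreases until \<open>v\<close> is
  reached.\<close>

lemma polyhedron_graph_connected:
  fixes S :: "'a::euclidean_space set"
  assumes S: "polyhedron S" and u: "u extreme_point_of S" and v: "v extreme_point_of S"
  shows "(graph_adj S)\<^sup>*\<^sup>* u v"
proof -
  have "{v} exposed_face_of S"
    using S v by (simp add: exposed_face_of_polyhedron face_of_singleton)
  then obtain a b where ab: "S \<subseteq> {x. a \<bullet> x \<le> b}" "{v} = S \<inter> {x. a \<bullet> x = b}"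
    unfolding exposed_face_of_def by blast
  define c where "c = - a"
  have below: "c \<bullet> v \<le> c \<bullet> x" if "x \<in> S" for x using that ab by (auto simp: c_def)
  have strict: "c \<bullet> v < c \<bullet> x" if "x \<in> S" "x \<noteq> v" for x
  proof -
    have "a \<bullet> x \<noteq> b" "a \<bullet> x \<le> b" "a \<bullet> v = b" using that ab by blast+
    then show ?thesis by (simp add: c_def)
  qed
  have fin: "finite {w. w extreme_point_of S}" using S by (rule finite_polyhedron_extreme_points)
  show ?thesis
    using u
  proof (induction "card {w. w extreme_point_of S \<and> c \<bullet> w < c \<bullet> u}" arbitrary: u rule: less_induct)
    case less
    show ?case
    proof (cases "u = v")
      case False
      have "u \<in> S" "v \<in> S" using less.prems v by (auto simp: extreme_point_of_def)
      then obtain w where w: "graph_adj S u w" "c \<bullet> w < c \<bullet> u"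
        using descending_neighbour[OF S less.prems \<open>v \<in> S\<close> strict below] False by blast
      have ext: "w extreme_point_of S" using w by (simp add: graph_adj_def)
      have "card {x. x extreme_point_of S \<and> c \<bullet> x < c \<bullet> w}
          < card {x. x extreme_point_of S \<and> c \<bullet> x < c \<bullet> u}"
        using w ext by (intro psubset_card_mono finite_subset[OF _ fin]) auto
      then have "(graph_adj S)\<^sup>*\<^sup>* w v" using less.hyps ext by blast
      then show ?thesis using w(1) by (rule converse_rtranclp_into_rtranclp[rotated])
    qed simp
  qed
qed

section \<open>Layers of vertices\<close>

text \<open>The combinatorial core, free of geometry: \<open>I G\<close> will be the layers met by a
  facet, and \<open>bound\<close> will come from the induction on the dimension. The factor 2 is
  paid once per dimension, which produces \<open>2 ^ d\<close>. \<open>Suc e - s\<close> counts the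
  layers \<open>s\<close> to \<open>e\<close> and is 0 if there are none.\<close>

lemma interval_cover_bound:
  fixes I :: "'b \<Rightarrow> nat set" and c e s :: nat
  assumes fin: "finite \<G>" and le: "\<And>G. G \<in> \<G> \<Longrightarrow> I G \<subseteq> {..e}"
    and interval: "\<And>G i j k. G \<in> \<G> \<Longrightarrow> i \<in> I G \<Longrightarrow> k \<in> I G \<Longrightarrow> i \<le> j \<Longrightarrow> j \<le> k \<Longrightarrow> j \<in> I G"
    and cover: "\<And>i. s \<le> i \<Longrightarrow> i \<le> e \<Longrightarrow> \<exists>G\<in>\<G>. i \<in> I G"
    and bound: "\<And>G a b. G \<in> \<G> \<Longrightarrow> a \<le> b \<Longrightarrow> {a..b} \<subseteq> I G \<Longrightarrow>
      Suc b - a \<le> c * card {H \<in> \<G>. I H \<inter> {a..b} \<noteq> {}}"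
  shows "Suc e - s \<le> c * (2 * card \<G>)"
proof -
  text \<open>As the greedy cover advances, each \<open>H\<close> is charged when it leaves \<open>Y\<close> and when it
    leaves \<open>X\<close>, hence at most twice.\<close>
  define X where "X r = {H \<in> \<G>. \<exists>x\<in>I H. r \<le> x}" for r
  define Y where "Y r = {H \<in> \<G>. I H \<noteq> {} \<and> (\<forall>x\<in>I H. r \<le> x)}" for r
  have finX: "finite (X r)" and finY: "finite (Y r)" for r using fin by (auto simp: X_def Y_def)
  have "Suc e - r \<le> c * (card (X r) + card (Y r))" if "s \<le> r" for r
    using that
  proof (induction "Suc e - r" arbitrary: r rule: less_induct)
    case less
    show ?case
    proof (cases "r \<le> e")
      case True
      \<comment> \<open>\<open>R\<close> collects everything reached by the sets that contain
        \<open>r\<close>. Its maximum \<open>q\<close> is the greedy reach, and the next round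
        starts at \<open>Suc q\<close>.\<close>
      define R where "R = \<Union> (I ` {G \<in> \<G>. r \<in> I G})"
      have "finite R" using le by (intro finite_subset[of R "{..e}"]) (auto simp: R_def)
      have "r \<in> R" using cover[OF less.prems True] by (auto simp: R_def)
      define q where "q = Max R"
      have "r \<le> q" using \<open>finite R\<close> \<open>r \<in> R\<close> by (simp add: q_def)
      have "q \<in> R" using \<open>finite R\<close> \<open>r \<in> R\<close> by (auto simp: q_def intro: Max_in)
      then obtain G where G: "G \<in> \<G>" "r \<in> I G" "q \<in> I G" by (auto simp: R_def)
      have max: "x \<le> q" if "H \<in> \<G>" "r \<in> I H" "x \<in> I H" for H x
        using that \<open>finite R\<close> by (auto simp: q_def R_def intro!: Max_ge)
      define M where "M = {H \<in> \<G>. I H \<inter> {r..q} \<noteq> {}}"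
      have "{r..q} \<subseteq> I G" using interval[OF G] by auto
      then have 1: "Suc q - r \<le> c * card M" using bound[OF G(1) \<open>r \<le> q\<close>] by (simp add: M_def)
      have 2: "Suc e - Suc q \<le> c * (card (X (Suc q)) + card (Y (Suc q)))"
        using less.hyps[of "Suc q"] less.prems \<open>r \<le> q\<close> True by auto
      have subX: "X (Suc q) \<subseteq> X r" and subY: "Y (Suc q) \<subseteq> Y r"
        using \<open>r \<le> q\<close> by (auto simp: X_def Y_def dest: Suc_leD intro: order_trans)
      \<comment> \<open>A set \<open>H\<close> that meets \<open>{r..q}\<close> and does not pass
        \<open>q\<close> leaves \<open>X\<close>. If it passes \<open>q\<close>, maximality of
        \<open>q\<close> excludes \<open>r\<close> from \<open>I H\<close>; being an interval,
        \<open>I H\<close> then lies wholly above \<open>r\<close>, so \<open>H\<close> leaves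
        \<open>Y\<close>.\<close>
      have "M \<subseteq> (X r - X (Suc q)) \<union> (Y r - Y (Suc q))"
      proof
        fix H assume "H \<in> M"
        then obtain x where H: "H \<in> \<G>" and x: "x \<in> I H" "r \<le> x" "x \<le> q"
          by (auto simp: M_def)
        show "H \<in> (X r - X (Suc q)) \<union> (Y r - Y (Suc q))"
        proof (cases "H \<in> X (Suc q)")
          case True
          then obtain y where "y \<in> I H" "Suc q \<le> y" by (auto simp: X_def)
          then have "r \<notin> I H" using max[OF H] by fastforce
          then have "r \<le> w" if "w \<in> I H" for w
            using interval[OF H that x(1), of r] x(2) by force
          then have "H \<in> Y r" using H x(1) by (auto simp: Y_def)
          moreover have "H \<notin> Y (Suc q)" using x by (force simp: Y_def)
          ultimately show ?thesis by blast
        qed (use H x in \<open>auto simp: X_def\<close>)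
      qed
      then have "card M \<le> card (X r - X (Suc q)) + card (Y r - Y (Suc q))"
        using card_mono[of "(X r - X (Suc q)) \<union> (Y r - Y (Suc q))" M] finX finY
        by (meson card_Un_le finite_Diff finite_UnI order_trans)
      also have "\<dots> = (card (X r) - card (X (Suc q))) + (card (Y r) - card (Y (Suc q)))"
        by (simp add: card_Diff_subset finX finY subX subY)
      finally have "card M + (card (X (Suc q)) + card (Y (Suc q))) \<le> card (X r) + card (Y r)"
        using card_mono[OF finX subX] card_mono[OF finY subY] by linarith
      then have "c * card M + c * (card (X (Suc q)) + card (Y (Suc q))) \<le> c * (card (X r) + card (Y r))"
        by (metis add_mult_distrib2 mult_le_mono2)
      then show ?thesis using 1 2 by linarith
    qed simp
  qed
  from this[of s] have "Suc e - s \<le> c * (card (X s) + card (Y s))" by simp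
  also have "\<dots> \<le> c * (2 * card \<G>)"
    using card_mono[OF fin, of "X s"] card_mono[OF fin, of "Y s"]
    by (intro mult_le_mono2) (auto simp: X_def Y_def)
  finally show ?thesis .
qed

section \<open>Layers met by the faces of a polyhedron\<close>

lemma graph_adj_face:
  assumes "F face_of P" "graph_adj F v w"
  shows "graph_adj P v w"
  using assms by (auto simp: graph_adj_def edge_of_def extreme_point_of_face intro: face_of_trans)

text \<open>The graph of \<open>F\<close> is itself connected, and the level rises by at most one
  along each edge, so a path inside \<open>F\<close> from \<open>v\<close> to \<open>w\<close>
  cannot skip level \<open>j\<close>.\<close>

lemma face_layers_interval:
  fixes P :: "'a::euclidean_space set" and lev :: "'a \<Rightarrow> nat"
  assumes P: "polyhedron P" and F: "F face_of P"
    and step: "\<And>v w. graph_adj P v w \<Longrightarrow> lev w \<le> Suc (lev v)"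
    and v: "v extreme_point_of P" "v \<in> F" and w: "w extreme_point_of P" "w \<in> F"
    and j: "lev v \<le> j" "j \<le> lev w"
  shows "\<exists>x\<in>F. x extreme_point_of P \<and> lev x = j"
proof -
  have "(graph_adj F)\<^sup>*\<^sup>* v w"
    using P F v w
    by (intro polyhedron_graph_connected)
      (auto simp: extreme_point_of_face intro: face_of_polyhedron_polyhedron)
  then show ?thesis
    using j(2)
  proof induction
    case base
    then show ?case using v j by force
  next
    case (step y z)
    show ?case
    proof (cases "j \<le> lev y")
      case False
      have "lev z \<le> Suc (lev y)" using graph_adj_face[OF F step.hyps(2)] assms(3) by blast
      then have "lev z = j" using False step.prems by simp
      moreover have "z \<in> F" "z extreme_point_of P"
        using step.hyps(2) F by (auto simp: graph_adj_def extreme_point_of_face)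
      ultimately show ?thesis by blast
    qed (use step.IH in blast)
  qed
qed

text \<open>The face \<open>{v}\<close> is the intersection of the facets through \<open>v\<close>,
  so any second point of \<open>F\<close> is missed by one of them.\<close>

lemma facet_missing_face:
  fixes P :: "'a::euclidean_space set"
  assumes P: "polyhedron P" and v: "v extreme_point_of P" "v \<in> F"
    and F: "F \<noteq> {v}" "F \<subseteq> P"
  shows "\<exists>H. H facet_of P \<and> v \<in> H \<and> \<not> F \<subseteq> H"
proof -
  have "{v} \<noteq> P" using v F by blast
  moreover have "{v} face_of P" using v(1) by (simp add: face_of_singleton)
  ultimately have "{v} = \<Inter> {H. H facet_of P \<and> {v} \<subseteq> H}"
    using face_of_polyhedron[OF P] by blast
  moreover obtain x where "x \<in> F" "x \<noteq> v" using F v by blast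
  ultimately have "\<exists>H. H facet_of P \<and> {v} \<subseteq> H \<and> x \<notin> H" by blast
  with \<open>x \<in> F\<close> show ?thesis by blast
qed

text \<open>Induction on \<open>d\<close>, covering the layers of \<open>F\<close> by its
  intersections with facets of \<open>P\<close>. Only facets that meet \<open>F\<close> in a vertex
  of the window \<open>{s..e}\<close> are counted; this locality is what lets the greedy cover add
  up the bounds of its pieces. The \<open>Suc\<close> covers the case of a single vertex and, in the
  induction step, the chosen facet.\<close>

lemma face_layers_bound:
  fixes P :: "'a::euclidean_space set" and lev :: "'a \<Rightarrow> nat"
  assumes P: "polyhedron P"
    and step: "\<And>v w. graph_adj P v w \<Longrightarrow> lev w \<le> Suc (lev v)"
    and "F face_of P" "aff_dim F \<le> int d"
    and "\<And>i. i \<in> {s..e} \<Longrightarrow> \<exists>v\<in>F. v extreme_point_of P \<and> lev v = i"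
  shows "Suc e - s \<le> 2 ^ d * Suc (card {H. H facet_of P \<and> \<not> F \<subseteq> H \<and>
    (\<exists>v\<in>F \<inter> H. v extreme_point_of P \<and> lev v \<in> {s..e})})"
  using assms(3-)
proof (induction d arbitrary: F s e)
  have singleton: "Suc e - s \<le> 1"
    if "\<And>i. i \<in> {s..e} \<Longrightarrow> \<exists>v\<in>F. v extreme_point_of P \<and> lev v = i" "F = {v}"
    for F s e v
  proof (cases "s \<le> e")
    case True
    then have "lev v = s" "lev v = e" using that(1)[of s] that(1)[of e] that(2) by auto
    then show ?thesis by simp
  qed simp
  {
    case 0
    show ?case
    proof (cases "s \<le> e")
      case True
      then have "F \<noteq> {}" using 0(3)[of s] by auto
      then have "aff_dim F = 0" using 0(2) aff_dim_geq[of F] aff_dim_empty[of F] by linarith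
      then obtain v where "F = {v}" using aff_dim_eq_0 by blast
      then have "Suc e - s \<le> 1" using singleton 0(3) by blast
      then show ?thesis by simp
    qed simp
  next
    case (Suc d)
    show ?case
    proof (cases "\<exists>v. F = {v}")
      case True
      then have "Suc e - s \<le> 1" using singleton Suc.prems(3) by blast
      moreover have "1 \<le> 2 ^ Suc d * Suc n" for n :: nat
        by (simp only: One_nat_def Suc_le_eq nat_0_less_mult_iff) simp
      ultimately show ?thesis by (rule order_trans)
    next
      case False
      define \<G> where "\<G> = {H. H facet_of P \<and> \<not> F \<subseteq> H \<and>
        (\<exists>v\<in>F \<inter> H. v extreme_point_of P \<and> lev v \<in> {s..e})}"
      define I where "I H = {i \<in> {s..e}. \<exists>v\<in>F \<inter> H. v extreme_point_of P \<and> lev v = i}" for H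
      have fin: "finite \<G>"
        using finite_polyhedron_facets[OF P] by (rule finite_subset[rotated]) (auto simp: \<G>_def)
      have FP: "F \<subseteq> P" using Suc.prems(1) by (rule face_of_imp_subset)
      have face: "F \<inter> G face_of P" if "G \<in> \<G>" for G
        using that Suc.prems(1) by (intro face_of_Int) (auto simp: \<G>_def facet_of_imp_face_of)
      have "Suc e - s \<le> 2 ^ d * (2 * card \<G>)"
      proof (rule interval_cover_bound[where I = I])
        show "finite \<G>" by (rule fin)
        show "I G \<subseteq> {..e}" for G by (auto simp: I_def)
        show "j \<in> I G" if G: "G \<in> \<G>" and ik: "i \<in> I G" "k \<in> I G" and j: "i \<le> j" "j \<le> k"
          for G i j k
        proof -
          obtain v where v: "v \<in> F \<inter> G" "v extreme_point_of P" "lev v = i"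
            using ik(1) unfolding I_def by blast
          obtain w where w: "w \<in> F \<inter> G" "w extreme_point_of P" "lev w = k"
            using ik(2) unfolding I_def by blast
          have "\<exists>x\<in>F \<inter> G. x extreme_point_of P \<and> lev x = j"
            by (rule face_layers_interval[where lev = lev, OF P face[OF G] step v(2,1) w(2,1)])
              (simp_all add: v w j)
          then show ?thesis using ik j by (auto simp: I_def)
        qed
        show "\<exists>G\<in>\<G>. i \<in> I G" if i: "s \<le> i" "i \<le> e" for i
        proof -
          obtain v where v: "v \<in> F" "v extreme_point_of P" "lev v = i"
            using Suc.prems(3)[of i] i by auto
          have "F \<noteq> {v}" using False by blast
          with facet_missing_face[OF P v(2,1) _ FP]
          obtain H where "H facet_of P" "v \<in> H" "\<not> F \<subseteq> H" by metis
          then have "H \<in> \<G>" "i \<in> I H" using v i by (auto simp: \<G>_def I_def)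
          then show ?thesis by blast
        qed
        show "Suc b - a \<le> 2 ^ d * card {H \<in> \<G>. I H \<inter> {a..b} \<noteq> {}}"
          if G: "G \<in> \<G>" and ab: "a \<le> b" "{a..b} \<subseteq> I G" for G a b
        proof -
          define N where "N = {H. H facet_of P \<and> \<not> F \<inter> G \<subseteq> H \<and>
            (\<exists>v\<in>F \<inter> G \<inter> H. v extreme_point_of P \<and> lev v \<in> {a..b})}"
          have "F \<inter> G face_of F" using face[OF G] Suc.prems(1) FP
            by (meson face_of_subset inf_le1)
          moreover have "F \<inter> G \<noteq> F" using G by (auto simp: \<G>_def)
          ultimately have "aff_dim (F \<inter> G) < aff_dim F"
            using Suc.prems(1) face_of_aff_dim_lt face_of_imp_convex by blast
          then have "aff_dim (F \<inter> G) \<le> int d" using Suc.prems(2) by simp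
          then have "Suc b - a \<le> 2 ^ d * Suc (card N)"
            unfolding N_def using face[OF G] ab by (intro Suc.IH) (auto simp: I_def)
          \<comment> \<open>The extra 1 pays for \<open>G\<close>, which contains
            \<open>F \<inter> G\<close> and is therefore not in \<open>N\<close>.\<close>
          also have "Suc (card N) = card (insert G N)"
            using finite_polyhedron_facets[OF P]
            by (subst card_insert_disjoint) (auto simp: N_def)
          also have "\<dots> \<le> card {H \<in> \<G>. I H \<inter> {a..b} \<noteq> {}}"
          proof (rule card_mono)
            have sub: "{a..b} \<subseteq> {s..e}" using ab by (auto simp: I_def)
            have "I G \<inter> {a..b} = {a..b}" using ab(2) by blast
            then have "G \<in> {H \<in> \<G>. I H \<inter> {a..b} \<noteq> {}}" using G ab(1) by simp
            moreover have "H \<in> {H \<in> \<G>. I H \<inter> {a..b} \<noteq> {}}" if "H \<in> N" for H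
            proof -
              obtain v where H: "H facet_of P" "\<not> F \<inter> G \<subseteq> H"
                and v: "v \<in> F \<inter> H" "v extreme_point_of P" "lev v \<in> {a..b}"
                using \<open>H \<in> N\<close> by (auto simp: N_def)
              have "lev v \<in> {s..e}" using v(3) sub by blast
              then have "H \<in> \<G>" "lev v \<in> I H" using H v by (auto simp: \<G>_def I_def)
              with v(3) show ?thesis by blast
            qed
            ultimately show "insert G N \<subseteq> {H \<in> \<G>. I H \<inter> {a..b} \<noteq> {}}" by blast
          qed (use fin in simp)
          finally show ?thesis by simp
        qed
      qed
      also have "\<dots> \<le> 2 ^ Suc d * Suc (card \<G>)" by simp
      finally show ?thesis unfolding \<G>_def .
    qed
  }
qed

section \<open>From layers to the diameter\<close>

lemma graph_dist_le:
  fixes P :: "'a::euclidean_space set"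
  assumes P: "polyhedron P" and dim: "aff_dim P \<le> int d"
    and u: "u extreme_point_of P" and v: "v extreme_point_of P"
  shows "graph_dist P u v \<le> enat (2 ^ d * Suc (card {F. F facet_of P}))"
proof -
  \<comment> \<open>The layers are those of breadth-first search from \<open>u\<close>. Every vertex
    is reached because the graph is connected, so \<open>LEAST\<close> is a true minimum
    there.\<close>
  define lev where "lev x = (LEAST k. (graph_adj P ^^ k) u x)" for x
  have reach: "\<exists>k. (graph_adj P ^^ k) u x" if "x extreme_point_of P" for x
    using polyhedron_graph_connected[OF P u that] rtranclp_imp_relpowp by metis
  have lev: "(graph_adj P ^^ lev x) u x" if "x extreme_point_of P" for x
    unfolding lev_def using reach[OF that] by (rule LeastI_ex)
  have step: "lev y \<le> Suc (lev x)" if "graph_adj P x y" for x y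
  proof -
    have "(graph_adj P ^^ lev x) u x" using that lev by (simp add: graph_adj_def)
    then have "(graph_adj P ^^ Suc (lev x)) u y" using that by (rule relpowp_Suc_I)
    then show ?thesis unfolding lev_def[of y] by (rule Least_le)
  qed
  have "lev u = 0" unfolding lev_def by (rule Least_eq_0) simp
  have face: "P face_of P" using P by (simp add: face_of_refl polyhedron_imp_convex)
  \<comment> \<open>The layer bound is applied to \<open>P\<close> as a face of itself, with the
    window from the layer of \<open>u\<close> to that of \<open>v\<close>; no layer in between is
    empty.\<close>
  have "Suc (lev v) - 0 \<le> 2 ^ d * Suc (card {H. H facet_of P \<and> \<not> P \<subseteq> H \<and>
    (\<exists>x\<in>P \<inter> H. x extreme_point_of P \<and> lev x \<in> {0..lev v})})"
  proof (rule face_layers_bound[OF P step face dim])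
    show "\<exists>x\<in>P. x extreme_point_of P \<and> lev x = i" if "i \<in> {0..lev v}" for i
      using that u v \<open>lev u = 0\<close>
      by (intro face_layers_interval[OF P face step]) (auto simp: extreme_point_of_def)
  qed
  also have "\<dots> \<le> 2 ^ d * Suc (card {F. F facet_of P})"
    using finite_polyhedron_facets[OF P]
    by (intro mult_le_mono2 Suc_le_mono[THEN iffD2] card_mono) auto
  finally have "lev v \<le> 2 ^ d * Suc (card {F. F facet_of P})" by simp
  moreover have "graph_dist P u v \<le> enat (lev v)"
    unfolding graph_dist_def using lev[OF v] by (intro INF_lower) simp
  ultimately show ?thesis by (meson enat_ord_simps(1) order_trans)
qed

lemma Delta_u_linear_bound:
  "Delta_u TYPE('a::euclidean_space) d n \<le> enat (2 ^ d * Suc n)"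
  unfolding Delta_u_def graph_diameter_def
proof (intro SUP_least)
  fix P :: "'a set" and u v
  assume "P \<in> {P. polyhedron P \<and> aff_dim P = int d \<and> card {F. F facet_of P} = n}"
    and "u \<in> {u. u extreme_point_of P}" "v \<in> {v. v extreme_point_of P}"
  then show "graph_dist P u v \<le> enat (2 ^ d * Suc n)"
    using graph_dist_le[of P d u v] by simp
qed

theorem theorem7p2:
  fixes d :: nat and \<epsilon> :: real
  assumes "\<epsilon> > 0" and "d \<ge> 3"
  shows "\<forall>\<^sub>F n in sequentially.
           ereal_of_enat (Delta_u TYPE('a::euclidean_space) d n)
             \<le> ereal (real n powr (1 + 1 / ln 2 + \<epsilon>))"
proof -
  \<comment> \<open>Since \<open>\<delta>\<close> is positive and \<open>d\<close> is fixed,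
    \<open>n powr (1 + \<delta>)\<close> eventually exceeds the bound linear in
    \<open>n\<close>.\<close>
  define \<delta> where "\<delta> = 1 / ln 2 + \<epsilon>"
  have "\<delta> > 0" using assms(1) by (simp add: \<delta>_def add_pos_pos)
  then have "\<forall>\<^sub>F n in sequentially. 2 ^ d * real (Suc n) \<le> real n powr (1 + \<delta>)"
    by real_asymp
  then show ?thesis
  proof eventually_elim
    case (elim n)
    have "ereal_of_enat (Delta_u TYPE('a) d n) \<le> ereal_of_enat (enat (2 ^ d * Suc n))"
      using Delta_u_linear_bound by (simp only: ereal_of_enat_le_iff)
    also have "\<dots> = ereal (2 ^ d * real (Suc n))" by (simp add: distrib_left)
    also have "\<dots> \<le> ereal (real n powr (1 + 1 / ln 2 + \<epsilon>))"
      using elim by (simp add: \<delta>_def add.assoc)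
    finally show ?case .
  qed
qed

end
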